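(* Consider the heterogeneous discrete Bass model on the one-sided circle with $M$ nodes, where each nonadopter $j$ adopts at rate $p_j+q_jX_{j-1}(t)$. Then the expected fraction of adopters is $$f^{\rm 1-sided}_{\rm circle}(t)=1-\frac1M\sum_{j=1}^M[S_1^j](t),\qquad [S_1^j](t)=\sum_{k=1}^M c_k^j\,v_k^j(1)\,e^{\lambda_k^jt},$$ where $[S_1^j](t)$ is the probability that node $j$ is a nonadopter at time $t$, $$\lambda_k^j=\begin{cases}\Big(-\sum_{i=j-k+1}^{j}p_i\Big)-q_{j-k+1},& k=1,\dots,M-1,\\ -\sum_{i=1}^M p_i,& k=M,\end{cases}$$ $$v_k^j(1)=\begin{cases}1,& k=1,\\ \displaystyle\prod_{m=j-k+2}^{j}\frac{-q_m}{\Big(\sum_{i=j-k+1}^{m-1}p_i\Big)+q_{j-k+1}-q_m},& k=2,\dots,M-1,\\ \displaystyle\prod_{m=j-M+2}^{j}\frac{-q_m}{\Big(\sum_{i=j-M+1}^{m-1}p_i\Big)-q_m},& k=M,\end{cases}$$ $c_M^j=1$, and for $k=M-1,\dots,1$, $$c_k^j=1-\prod_{m=j+1-(M-1)}^{j+1-k}\frac{-q_m}{\Big(\sum_{i=j-M+1}^{m-1}p_i\Big)-q_m}-\sum_{l=k+1}^{M-1}\left(\prod_{m=j-l+2}^{j-k+1}\frac{-q_m}{\Big(\sum_{i=j-l+1}^{m-1}p_i\Big)+q_{j-l+1}-q_m}\right)c_l^j.$$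
   Context: One-sided circle model: nodes $1,\dots,M$ with external rates $p_j\ge0$ and internal rates $q_j>0$. $X_j(t)\in\{0,1\}$ is the state of node $j$ ($1$ = adopter), $X_j(0)=0$ for all $j$. The process $(X_1,\dots,X_M)$ is a continuous-time Markov chain in which adopters remain adopters forever, and each nonadopter $j$ becomes an adopter at rate $p_j+q_jX_{j-1}(t)$ (one node changes at a time), i.e. each node is influenced only by its left neighbor. The expected fraction of adopters is $f(t)=\frac1M\,\mathbf{E}\big[\sum_{j=1}^M X_j(t)\big]$, written $f^{\rm 1-sided}_{\rm circle}(t)$ for this network. Subscripts of $p$, $q$ and $X$ are understood modulo $M$, taken in $\{1,\dots,M\}$ (so e.g. $q_0=q_M$, $p_{-1}=p_{M-1}$), while sums and products run over the indicated consecutive integers.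
   Formalization: The explicit formula for [S_1^j](t) is claimed for those nodes j for which no denominator in v_k^j(1) and c_k^j vanishes; for some rates (e.g. M=2, p_1=q_2) the formula as printed divides by zero. The identity for f in terms of the nonadopter probabilities holds without this condition. *)

theory Defs
  imports "HOL-Probability.Probability"
begin

text \<open>Continuous-time Markov chains on a finite state space \<open>S\<close> with jump rates
  \<open>r x y\<close> (\<open>x \<noteq> y\<close>). The limit at \<open>0\<close> is only imposed off the diagonal: the rows of \<open>P h\<close>
  sum to 1 and \<open>S\<close> is finite, so the diagonal entry of the generator is then
  \<open>- (\<Sum>y\<in>S - {x}. r x y)\<close>.\<close>

definition transition_function ::
    "'s set \<Rightarrow> ('s \<Rightarrow> 's \<Rightarrow> real) \<Rightarrow> (real \<Rightarrow> 's \<Rightarrow> 's \<Rightarrow> real) \<Rightarrow> bool" where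
  "transition_function S r P \<longleftrightarrow>
     (\<forall>h\<ge>0. \<forall>x\<in>S. (\<forall>y\<in>S. 0 \<le> P h x y) \<and> (\<Sum>y\<in>S. P h x y) = 1) \<and>
     (\<forall>x\<in>S. \<forall>y\<in>S. P 0 x y = of_bool (x = y)) \<and>
     (\<forall>s\<ge>0. \<forall>h\<ge>0. \<forall>x\<in>S. \<forall>z\<in>S. P (s + h) x z = (\<Sum>y\<in>S. P s x y * P h y z)) \<and>
     (\<forall>x\<in>S. \<forall>y\<in>S. x \<noteq> y \<longrightarrow> ((\<lambda>h. P h x y / h) \<longlongrightarrow> r x y) (at_right 0))"

text \<open>In the Markov property, \<open>T\<close> is an arbitrary finite set of times up to \<open>t\<close> and \<open>\<xi>\<close>
  prescribes the states at these times. The equation is the conditional-probability statement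
  multiplied out, so that conditioning events of probability 0 need no special treatment.\<close>

definition ctmc ::
    "'w measure \<Rightarrow> 's set \<Rightarrow> ('s \<Rightarrow> 's \<Rightarrow> real) \<Rightarrow> (real \<Rightarrow> 'w \<Rightarrow> 's) \<Rightarrow> bool" where
  "ctmc \<Omega> S r X \<longleftrightarrow>
     prob_space \<Omega> \<and> finite S \<and> (\<forall>t\<ge>0. X t \<in> measurable \<Omega> (count_space S)) \<and>
     (\<exists>P. transition_function S r P \<and>
        (\<forall>T t h \<xi>. \<forall>x\<in>S. \<forall>y\<in>S. finite T \<and> T \<subseteq> {0..t} \<and> 0 \<le> t \<and> 0 \<le> h \<longrightarrow>
           measure \<Omega> {\<omega> \<in> space \<Omega>. (\<forall>s\<in>T. X s \<omega> = \<xi> s) \<and> X t \<omega> = x \<and> X (t + h) \<omega> = y}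
           = measure \<Omega> {\<omega> \<in> space \<Omega>. (\<forall>s\<in>T. X s \<omega> = \<xi> s) \<and> X t \<omega> = x} * P h x y))"

text \<open>Subscripts modulo \<open>M\<close>, with representatives in \<open>{1..M}\<close>. Node numbers and all other
  indices are integers, since expressions such as \<open>j - k + 1\<close> may be \<open>\<le> 0\<close>.\<close>

definition cyc :: "int \<Rightarrow> (int \<Rightarrow> 'a) \<Rightarrow> int \<Rightarrow> 'a" where
  "cyc M a i = a ((i - 1) mod M + 1)"

definition bass_states :: "int \<Rightarrow> (int \<Rightarrow> nat) set" where
  "bass_states M = {1..M} \<rightarrow>\<^sub>E {0, 1}"

text \<open>At most one index \<open>j\<close> contributes to the sum. The rate is 0 unless \<open>y\<close> arises from
  \<open>x\<close> by a single nonadopter becoming an adopter; in particular adopters remain adopters.\<close>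

definition bass_rate ::
    "int \<Rightarrow> (int \<Rightarrow> real) \<Rightarrow> (int \<Rightarrow> real) \<Rightarrow> (int \<Rightarrow> nat) \<Rightarrow> (int \<Rightarrow> nat) \<Rightarrow> real" where
  "bass_rate M p q x y =
     (\<Sum>j | j \<in> {1..M} \<and> x j = 0 \<and> y = x(j := 1). p j + q j * real (cyc M x (j - 1)))"

text \<open>\<open>X j t \<omega>\<close> is the state of node \<open>j\<close> at time \<open>t\<close>.\<close>

definition bass_circle ::
    "'w measure \<Rightarrow> int \<Rightarrow> (int \<Rightarrow> real) \<Rightarrow> (int \<Rightarrow> real) \<Rightarrow> (int \<Rightarrow> real \<Rightarrow> 'w \<Rightarrow> nat) \<Rightarrow> bool" where
  "bass_circle \<Omega> M p q X \<longleftrightarrow>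
     ctmc \<Omega> (bass_states M) (bass_rate M p q) (\<lambda>t \<omega>. \<lambda>j\<in>{1..M}. X j t \<omega>) \<and>
     (AE \<omega> in \<Omega>. \<forall>j\<in>{1..M}. X j 0 \<omega> = 0)"

definition adopter_fraction ::
    "'w measure \<Rightarrow> int \<Rightarrow> (int \<Rightarrow> real \<Rightarrow> 'w \<Rightarrow> nat) \<Rightarrow> real \<Rightarrow> real" where
  "adopter_fraction \<Omega> M X t =
     1 / real_of_int M * integral\<^sup>L \<Omega> (\<lambda>\<omega>. \<Sum>j=1..M. real (X j t \<omega>))"

definition nonadopter_prob ::
    "'w measure \<Rightarrow> (int \<Rightarrow> real \<Rightarrow> 'w \<Rightarrow> nat) \<Rightarrow> int \<Rightarrow> real \<Rightarrow> real" where
  "nonadopter_prob \<Omega> X j t = measure \<Omega> {\<omega> \<in> space \<Omega>. X j t \<omega> = 0}"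

definition lam :: "int \<Rightarrow> (int \<Rightarrow> real) \<Rightarrow> (int \<Rightarrow> real) \<Rightarrow> int \<Rightarrow> int \<Rightarrow> real" where
  "lam M p q j k =
     (if k < M then - (\<Sum>i=j-k+1..j. cyc M p i) - cyc M q (j-k+1)
      else - (\<Sum>i=1..M. cyc M p i))"

text \<open>The first component of the \<open>k\<close>-th eigenvector. For \<open>M = 1\<close> the cases \<open>k = 1\<close> and
  \<open>k = M\<close> overlap and agree, the product being empty.\<close>

definition v1 :: "int \<Rightarrow> (int \<Rightarrow> real) \<Rightarrow> (int \<Rightarrow> real) \<Rightarrow> int \<Rightarrow> int \<Rightarrow> real" where
  "v1 M p q j k =
     (if k = 1 then 1
      else if k < M then
        (\<Prod>m=j-k+2..j. - cyc M q m / ((\<Sum>i=j-k+1..m-1. cyc M p i) + cyc M q (j-k+1) - cyc M q m))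
      else
        (\<Prod>m=j-M+2..j. - cyc M q m / ((\<Sum>i=j-M+1..m-1. cyc M p i) - cyc M q m)))"

text \<open>Only the values for \<open>1 \<le> k \<le> M\<close> are meaningful.\<close>

function coef :: "int \<Rightarrow> (int \<Rightarrow> real) \<Rightarrow> (int \<Rightarrow> real) \<Rightarrow> int \<Rightarrow> int \<Rightarrow> real" where
  "coef M p q j k =
     (if k \<ge> M then 1
      else 1
        - (\<Prod>m=j+1-(M-1)..j+1-k. - cyc M q m / ((\<Sum>i=j-M+1..m-1. cyc M p i) - cyc M q m))
        - (\<Sum>l=k+1..M-1.
             (\<Prod>m=j-l+2..j-k+1.
                - cyc M q m / ((\<Sum>i=j-l+1..m-1. cyc M p i) + cyc M q (j-l+1) - cyc M q m))
             * coef M p q j l))"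
  by pat_completeness auto
termination
  by (relation "Wellfounded.measure (\<lambda>(M, p, q, j, k). nat (M - k))") auto

declare coef.simps [simp del]

text \<open>No denominator occurring in \<open>v1 M p q j k\<close> or \<open>coef M p q j k\<close> for \<open>1 \<le> k \<le> M\<close> vanishes.
  The denominators in \<open>coef\<close> are among those in \<open>v1\<close>.\<close>

definition nonzero_denominators ::
    "int \<Rightarrow> (int \<Rightarrow> real) \<Rightarrow> (int \<Rightarrow> real) \<Rightarrow> int \<Rightarrow> bool" where
  "nonzero_denominators M p q j \<longleftrightarrow>
     (\<forall>k\<in>{2..M-1}. \<forall>m\<in>{j-k+2..j}.
        (\<Sum>i=j-k+1..m-1. cyc M p i) + cyc M q (j-k+1) - cyc M q m \<noteq> 0) \<and>
     (\<forall>m\<in>{j-M+2..j}. (\<Sum>i=j-M+1..m-1. cyc M p i) - cyc M q m \<noteq> 0)"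

end

theory Submission
  imports Defs
begin

text \<open>Let \<open>S\<^sub>k(t)\<close> be the probability that the \<open>k\<close> consecutive nodes \<open>j - k + 1, \<dots>, j\<close> are all
  nonadopters. Only the leftmost of them can be influenced from outside, so the forward equation
  gives the triangular system \<open>S\<^sub>k' = \<lambda>\<^sub>k S\<^sub>k + q\<^sub>j\<^sub>-\<^sub>k\<^sub>+\<^sub>1 S\<^sub>k\<^sub>+\<^sub>1\<close> for \<open>k < M\<close> and
  \<open>S\<^sub>M' = \<lambda>\<^sub>M S\<^sub>M\<close>, with \<open>S\<^sub>k(0) = 1\<close>. The eigenvector expansion in the theorem solves the
  same initial value problem, and the solution is unique.\<close>

subsection \<open>The forward equation of a finite Markov semigroup\<close>

lemma transition_functionD:
  assumes "transition_function S r P"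
  shows transition_function_nonneg: "0 \<le> h \<Longrightarrow> x \<in> S \<Longrightarrow> y \<in> S \<Longrightarrow> 0 \<le> P h x y"
    and transition_function_sum: "0 \<le> h \<Longrightarrow> x \<in> S \<Longrightarrow> (\<Sum>y\<in>S. P h x y) = 1"
    and transition_function_start: "x \<in> S \<Longrightarrow> y \<in> S \<Longrightarrow> P 0 x y = of_bool (x = y)"
    and transition_function_add: "0 \<le> s \<Longrightarrow> 0 \<le> h \<Longrightarrow> x \<in> S \<Longrightarrow> z \<in> S \<Longrightarrow>
      P (s + h) x z = (\<Sum>y\<in>S. P s x y * P h y z)"
    and transition_function_rate: "x \<in> S \<Longrightarrow> y \<in> S \<Longrightarrow> x \<noteq> y \<Longrightarrow>
      ((\<lambda>h. P h x y / h) \<longlongrightarrow> r x y) (at_right 0)"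
proof -
  note * = assms[unfolded transition_function_def]
  show "0 \<le> P h x y" if "0 \<le> h" "x \<in> S" "y \<in> S"
    using conjunct1[OF *] that by blast
  show "(\<Sum>y\<in>S. P h x y) = 1" if "0 \<le> h" "x \<in> S"
    using conjunct1[OF *] that by blast
  show "P 0 x y = of_bool (x = y)" if "x \<in> S" "y \<in> S"
    by (rule *[THEN conjunct2, THEN conjunct1, rule_format, OF that])
  show "P (s + h) x z = (\<Sum>y\<in>S. P s x y * P h y z)"
    if "0 \<le> s" "0 \<le> h" "x \<in> S" "z \<in> S"
    by (rule *[THEN conjunct2, THEN conjunct2, THEN conjunct1, rule_format, OF that])
  show "((\<lambda>h. P h x y / h) \<longlongrightarrow> r x y) (at_right 0)" if "x \<in> S" "y \<in> S" "x \<noteq> y"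
    by (rule *[THEN conjunct2, THEN conjunct2, THEN conjunct2, rule_format, OF that])
qed

lemma transition_function_le_1:
  assumes "transition_function S r P" "finite S" "0 \<le> h" "x \<in> S" "y \<in> S"
  shows "P h x y \<le> 1"
  using member_le_sum[of y S "P h x"] transition_function_nonneg[OF assms(1,3,4)]
    transition_function_sum[OF assms(1,3,4)] assms by simp

text \<open>The rows of \<open>P h\<close> sum to 1, so \<open>g y\<close> can be moved inside the
  sum as \<open>g z - g y\<close>. The diagonal term then vanishes, and only the off-diagonal limits
  that define the rates remain.\<close>

lemma transition_function_generator:
  assumes tf: "transition_function S r P" and fin: "finite S" and y: "y \<in> S"
  shows "((\<lambda>h. ((\<Sum>z\<in>S. P h y z * g z) - g y) / h)
           \<longlongrightarrow> (\<Sum>z\<in>S - {y}. r y z * (g z - g y))) (at_right 0)"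
proof -
  have "((\<lambda>h. \<Sum>z\<in>S - {y}. P h y z / h * (g z - g y))
          \<longlongrightarrow> (\<Sum>z\<in>S - {y}. r y z * (g z - g y))) (at_right 0)"
    using y by (intro tendsto_sum tendsto_mult transition_function_rate[OF tf] tendsto_const) auto
  moreover have "(\<Sum>z\<in>S - {y}. P h y z / h * (g z - g y)) = ((\<Sum>z\<in>S. P h y z * g z) - g y) / h"
    if "h > 0" for h
  proof -
    have "(\<Sum>z\<in>S. P h y z) = 1"
      using transition_function_sum[OF tf] y that by simp
    then have "(\<Sum>z\<in>S. P h y z * g z) - g y = (\<Sum>z\<in>S. P h y z * (g z - g y))"
      by (simp add: right_diff_distrib sum_subtractf flip: sum_distrib_right)
    also have "\<dots> = (\<Sum>z\<in>S - {y}. P h y z * (g z - g y))"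
      using fin y by (simp add: sum.remove)
    finally show ?thesis
      by (simp add: sum_divide_distrib)
  qed
  ultimately show ?thesis
    by (rule_tac Lim_transform_eventually)
       (auto simp: eventually_at_right_field intro: exI[of _ 1])
qed

text \<open>Continuity of the semigroup at 0, obtained by multiplying the convergent difference
  quotient by \<open>h\<close>.\<close>

lemma transition_function_tendsto_0:
  assumes "transition_function S r P" "finite S" "y \<in> S"
  shows "((\<lambda>h. (\<Sum>z\<in>S. P h y z * g z) - g y) \<longlongrightarrow> 0) (at_right 0)"
proof -
  have "((\<lambda>h. ((\<Sum>z\<in>S. P h y z * g z) - g y) / h * h)
          \<longlongrightarrow> (\<Sum>z\<in>S - {y}. r y z * (g z - g y)) * 0) (at_right 0)"
    by (intro tendsto_mult transition_function_generator assms tendsto_ident_at)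
  then show ?thesis
    by (rule Lim_transform_eventually[OF tendsto_eq_rhs])
       (auto simp: eventually_at_right_field intro: exI[of _ 1])
qed

text \<open>Transfers limits at \<open>at_right 0\<close> to two-sided limits at \<open>t\<close>;
  the value \<open>s = t\<close>, where the distance would be 0, is excluded by the filter.\<close>

lemma filterlim_abs_diff_at_right_0:
  "filterlim (\<lambda>s::real. \<bar>s - t\<bar>) (at_right 0) (at t within A)"
  unfolding filterlim_at
proof
  show "\<forall>\<^sub>F s in at t within A. \<bar>s - t\<bar> \<in> {0<..} \<and> \<bar>s - t\<bar> \<noteq> 0"
    by (auto simp: eventually_at_filter)
  have "((\<lambda>s. \<bar>s - t\<bar>) \<longlongrightarrow> \<bar>t - t\<bar>) (at t within A)"
    by (intro tendsto_intros)
  then show "((\<lambda>s. \<bar>s - t\<bar>) \<longlongrightarrow> 0) (at t within A)"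
    by simp
qed

text \<open>Chapman-Kolmogorov with the step \<open>h\<close> taken last: the increment is the
  average, over the state at time \<open>s\<close>, of the effect of \<open>h\<close> on
  \<open>g\<close>.\<close>

lemma transition_function_increment:
  assumes tf: "transition_function S r P" and fin: "finite S" and x: "x \<in> S"
    and "0 \<le> s" "0 \<le> h"
  shows "(\<Sum>z\<in>S. P (s + h) x z * g z) - (\<Sum>z\<in>S. P s x z * g z)
         = (\<Sum>y\<in>S. P s x y * ((\<Sum>z\<in>S. P h y z * g z) - g y))"
proof -
  have "(\<Sum>z\<in>S. P (s + h) x z * g z) = (\<Sum>z\<in>S. \<Sum>y\<in>S. P s x y * P h y z * g z)"
    using assms by (intro sum.cong) (simp_all add: transition_function_add[OF tf] sum_distrib_right)
  also have "\<dots> = (\<Sum>y\<in>S. P s x y * (\<Sum>z\<in>S. P h y z * g z))"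
    by (subst sum.swap) (simp add: sum_distrib_left mult.assoc)
  finally show ?thesis
    by (simp add: right_diff_distrib sum_subtractf)
qed

text \<open>Only the approach from the left has content. There the weights in the increment formula
  vary with \<open>s\<close>, but they are at most 1, so a bound depending on \<open>t - s\<close>
  alone suffices.\<close>

lemma transition_function_min_tendsto:
  assumes tf: "transition_function S r P" and fin: "finite S" and x: "x \<in> S" and z: "z \<in> S"
    and t: "0 \<le> t"
  shows "((\<lambda>s. P (min s t) x z) \<longlongrightarrow> P t x z) (at t within {0..})"
proof -
  \<comment> \<open>The increment of the indicator of \<open>z\<close> over a time \<open>h\<close>,
    summed over all starting states with weight 1 in place of the unknown weights
    \<open>P s x y\<close>.\<close>
  define B where "B h = (\<Sum>y\<in>S. \<bar>(\<Sum>w\<in>S. P h y w * of_bool (w = z)) - of_bool (y = z)\<bar>)" for h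
  have "(B \<longlongrightarrow> (\<Sum>y\<in>S. \<bar>0\<bar>)) (at_right 0)"
    unfolding B_def
    by (intro tendsto_sum tendsto_rabs transition_function_tendsto_0[OF tf fin])
  then have "((\<lambda>s. B \<bar>s - t\<bar>) \<longlongrightarrow> 0) (at t within {0..})"
    using filterlim_compose[OF _ filterlim_abs_diff_at_right_0] by fastforce
  moreover have "\<bar>P (min s t) x z - P t x z\<bar> \<le> B \<bar>s - t\<bar>" if "0 \<le> s" for s
  proof (cases "s \<le> t")
    case True
    let ?g = "\<lambda>w. of_bool (w = z) :: real"
    have eval: "(\<Sum>w\<in>S. P u x w * ?g w) = P u x z" for u
      using fin z by simp
    have "P t x z - P s x z = (\<Sum>y\<in>S. P s x y * ((\<Sum>w\<in>S. P (t - s) y w * ?g w) - ?g y))"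
      using transition_function_increment[OF tf fin x, of s "t - s" ?g] True that
      unfolding eval by simp
    also have "\<bar>\<dots>\<bar> \<le> (\<Sum>y\<in>S. \<bar>P s x y * ((\<Sum>w\<in>S. P (t - s) y w * ?g w) - ?g y)\<bar>)"
      by (rule sum_abs)
    also have "\<dots> \<le> B (t - s)"
      unfolding B_def
    proof (intro sum_mono)
      fix y assume y: "y \<in> S"
      have "0 \<le> P s x y" "P s x y \<le> 1"
        using transition_function_le_1[OF tf fin \<open>0 \<le> s\<close> x y]
          transition_function_nonneg[OF tf \<open>0 \<le> s\<close> x y] by auto
      then show "\<bar>P s x y * ((\<Sum>w\<in>S. P (t - s) y w * ?g w) - ?g y)\<bar>
          \<le> \<bar>(\<Sum>w\<in>S. P (t - s) y w * ?g w) - ?g y\<bar>"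
        by (simp add: abs_mult mult_left_le_one_le)
    qed
    finally show ?thesis
      using True by (simp add: abs_minus_commute)
  next
    case False
    then show ?thesis
      by (simp add: B_def sum_nonneg)
  qed
  ultimately have "((\<lambda>s. P (min s t) x z - P t x z) \<longlongrightarrow> 0) (at t within {0..})"
    by (rule_tac Lim_null_comparison) (auto simp: eventually_at_filter)
  then show ?thesis
    by (simp add: LIM_zero_iff)
qed

text \<open>The derivatives from the left and from the right are treated together: the difference
  quotient between \<open>s\<close> and \<open>t\<close> is the increment over \<open>\<bar>s - t\<bar>\<close>, started at \<open>min s t\<close>.\<close>

lemma transition_function_forward_equation:
  assumes tf: "transition_function S r P" and fin: "finite S" and x: "x \<in> S" and t: "0 \<le> t"
  shows "((\<lambda>s. \<Sum>y\<in>S. P s x y * g y) has_real_derivative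
           (\<Sum>y\<in>S. P t x y * (\<Sum>z\<in>S - {y}. r y z * (g z - g y)))) (at t within {0..})"
proof -
  define A where "A h y = ((\<Sum>z\<in>S. P h y z * g z) - g y) / h" for h y
  let ?U = "\<lambda>s. \<Sum>y\<in>S. P s x y * g y"
  have incr: "(?U (s + h) - ?U s) / h = (\<Sum>y\<in>S. P s x y * A h y)"
    if "0 \<le> s" "0 \<le> h" for s h
    using transition_function_increment[OF tf fin x that, of g]
    by (simp add: A_def sum_divide_distrib)
  \<comment> \<open>The weights converge by continuity and the quotients \<open>A\<close> by the
    generator limit, so their products converge from both sides at once.\<close>
  have "((\<lambda>s. \<Sum>y\<in>S. P (min s t) x y * A \<bar>s - t\<bar> y) \<longlongrightarrow>
      (\<Sum>y\<in>S. P t x y * (\<Sum>z\<in>S - {y}. r y z * (g z - g y)))) (at t within {0..})"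
    unfolding A_def
    by (intro tendsto_sum tendsto_mult transition_function_min_tendsto[OF tf fin x _ t]
        filterlim_compose[OF transition_function_generator[OF tf fin]
          filterlim_abs_diff_at_right_0])
  moreover have "(\<Sum>y\<in>S. P (min s t) x y * A \<bar>s - t\<bar> y) = (?U s - ?U t) / (s - t)"
    if "0 \<le> s" "s \<noteq> t" for s
  proof (cases "s < t")
    \<comment> \<open>The increment now runs from \<open>s\<close> to \<open>t\<close>; numerator
      and denominator both change sign.\<close>
    case True
    then show ?thesis
      using incr[of s "t - s"] that minus_divide_divide[of "?U s - ?U t" "s - t"]
      by (simp add: min_def)
  next
    case False
    then show ?thesis
      using incr[of t "s - t"] that t by (simp add: min_def)
  qed
  ultimately show ?thesis
    unfolding has_field_derivative_iff
    by (rule_tac Lim_transform_eventually) (auto simp: eventually_at_filter)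
qed

subsection \<open>Triangular linear systems\<close>

text \<open>Descending induction from \<open>M + 1\<close>: once \<open>D (k + 1)\<close> vanishes,
  \<open>D k\<close> solves a homogeneous scalar equation with initial value 0.\<close>

lemma triangular_system_zero:
  fixes D :: "int \<Rightarrow> real \<Rightarrow> real"
  assumes deriv: "\<And>k t. k \<in> {1..M} \<Longrightarrow> 0 \<le> t \<Longrightarrow>
      (D k has_real_derivative \<mu> k * D k t + a k * D (k + 1) t) (at t within {0..})"
    and init: "\<And>k. k \<in> {1..M} \<Longrightarrow> D k 0 = 0"
    and top: "\<And>t. 0 \<le> t \<Longrightarrow> D (M + 1) t = 0"
    and "1 \<le> k" "k \<le> M + 1" "0 \<le> t"
  shows "D k t = 0"
proof -
  \<comment> \<open>The downward induction on integers has no lower end; the premise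
    \<open>1 \<le> k\<close> keeps it within the range of the system.\<close>
  from \<open>k \<le> M + 1\<close> have "1 \<le> k \<longrightarrow> (\<forall>t\<ge>0. D k t = 0)"
  proof (induction k rule: int_le_induct)
    case base
    then show ?case using top by simp
  next
    case (step k)
    show ?case
    proof (intro impI allI)
      fix t :: real assume k: "1 \<le> k - 1" and t: "0 \<le> t"
      \<comment> \<open>The integrating factor turns the scalar equation into the constancy of a
        product.\<close>
      have "((\<lambda>t. D (k - 1) t * exp (- \<mu> (k - 1) * t)) has_real_derivative 0) (at s within {0..})"
        if "s \<in> {0..}" for s
        using step k that
        by (auto intro!: derivative_eq_intros deriv[of "k - 1"] simp: algebra_simps)
      then have "\<exists>c. \<forall>s\<in>{0..}. D (k - 1) s * exp (- \<mu> (k - 1) * s) = c"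
        by (intro has_field_derivative_zero_constant) auto
      then obtain c where c: "\<And>s. s \<ge> 0 \<Longrightarrow> D (k - 1) s * exp (- \<mu> (k - 1) * s) = c"
        by auto
      have "c = 0"
        using c[of 0] init[of "k - 1"] k step by simp
      then show "D (k - 1) t = 0"
        using c[OF t] by simp
    qed
  qed
  then show ?thesis
    using assms by simp
qed

lemma triangular_system_unique:
  fixes F G :: "int \<Rightarrow> real \<Rightarrow> real"
  assumes F: "\<And>k t. k \<in> {1..M} \<Longrightarrow> 0 \<le> t \<Longrightarrow>
      (F k has_real_derivative \<mu> k * F k t + a k * F (k + 1) t) (at t within {0..})"
    and G: "\<And>k t. k \<in> {1..M} \<Longrightarrow> 0 \<le> t \<Longrightarrow>
      (G k has_real_derivative \<mu> k * G k t + a k * G (k + 1) t) (at t within {0..})"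
    and init: "\<And>k. k \<in> {1..M} \<Longrightarrow> F k 0 = G k 0"
    and top: "\<And>t. 0 \<le> t \<Longrightarrow> F (M + 1) t = G (M + 1) t"
    and "k \<in> {1..M}" "0 \<le> t"
  shows "F k t = G k t"
proof -
  have "(\<lambda>t. F k t - G k t) t = 0"
  proof (rule triangular_system_zero[where D = "\<lambda>k t. F k t - G k t" and M = M])
    fix k t assume "k \<in> {1..M}" "0 \<le> (t::real)"
    then show "((\<lambda>t. F k t - G k t) has_real_derivative
        \<mu> k * (F k t - G k t) + a k * (F (k + 1) t - G (k + 1) t)) (at t within {0..})"
      by (auto intro!: derivative_eq_intros F G simp: algebra_simps)
  qed (use assms in auto)
  then show ?thesis by simp
qed

text \<open>\<open>V l\<close> is the eigenvector for the eigenvalue \<open>\<mu> l\<close>.\<close>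

lemma triangular_system_solution:
  fixes V :: "int \<Rightarrow> int \<Rightarrow> real" and c :: "int \<Rightarrow> real"
  assumes V: "\<And>k l. 1 \<le> k \<Longrightarrow> k < l \<Longrightarrow> l \<le> M \<Longrightarrow> (\<mu> l - \<mu> k) * V l k = a k * V l (k + 1)"
    and F: "\<And>k t. F k t = (\<Sum>l=k..M. c l * V l k * exp (\<mu> l * t))"
    and k: "k \<in> {1..M}"
  shows "(F k has_real_derivative \<mu> k * F k t + a k * F (k + 1) t) (at t within A)"
proof -
  have "(F k has_real_derivative (\<Sum>l=k..M. c l * V l k * (exp (\<mu> l * t) * \<mu> l))) (at t within A)"
    unfolding F[abs_def] by (auto intro!: derivative_eq_intros sum.cong)
  moreover have "(\<Sum>l=k..M. c l * V l k * (exp (\<mu> l * t) * \<mu> l)) - \<mu> k * F k t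
      = (\<Sum>l=k..M. c l * exp (\<mu> l * t) * ((\<mu> l - \<mu> k) * V l k))"
    by (simp add: F sum_distrib_left flip: sum_subtractf) (simp add: algebra_simps)
  \<comment> \<open>The term \<open>l = k\<close> carries the factor
    \<open>\<mu> k - \<mu> k\<close>; the eigenvector equation applies to the remaining
    terms.\<close>
  moreover have "\<dots> = (\<Sum>l=k+1..M. c l * exp (\<mu> l * t) * ((\<mu> l - \<mu> k) * V l k))"
  proof -
    have "{k..M} = insert k {k+1..M}" using k by auto
    then show ?thesis by simp
  qed
  moreover have "\<dots> = a k * F (k + 1) t"
    using k V by (simp add: F sum_distrib_left mult_ac)
  ultimately show ?thesis
    by (simp add: diff_eq_eq add.commute)
qed

subsection \<open>Eigenvectors of the circle\<close>

text \<open>The index map inside \<open>cyc\<close>, isolated so that intervals of integers can be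
  mapped to sets of nodes.\<close>

definition node :: "int \<Rightarrow> int \<Rightarrow> int" where
  "node M i = (i - 1) mod M + 1"

lemma cyc_eq: "cyc M a i = a (node M i)"
  by (simp add: cyc_def node_def)

lemma node_mem:
  assumes "1 \<le> M"
  shows "node M i \<in> {1..M}"
proof -
  have "0 < M" using assms by simp
  from pos_mod_bound[OF this, of "i - 1"] pos_mod_sign[OF this, of "i - 1"]
  show ?thesis unfolding node_def atLeastAtMost_iff by arith
qed

lemma node_id: "i \<in> {1..M} \<Longrightarrow> node M i = i"
  by (auto simp: node_def)

lemma node_diff_self: "node M (i - M) = node M i"
proof -
  have "(i - M - 1) mod M = (i - 1 - M) mod M" by (simp add: algebra_simps)
  then show ?thesis by (simp add: node_def)
qed

lemma node_node_diff_1: "node M (node M i - 1) = node M (i - 1)"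
proof -
  have "((i - 1) mod M - 1) mod M = (i - 1 - 1) mod M" by (rule mod_diff_left_eq)
  then show ?thesis by (simp add: node_def)
qed

text \<open>The window holds at most \<open>M\<close> consecutive integers, so a difference
  divisible by \<open>M\<close> must be 0.\<close>

lemma inj_on_node:
  assumes "b - a < M"
  shows "inj_on (node M) {a..b}"
proof (rule inj_onI)
  fix x y assume xy: "x \<in> {a..b}" "y \<in> {a..b}" "node M x = node M y"
  then have "M dvd (x - 1) - (y - 1)"
    by (intro mod_eq_dvd_iff[THEN iffD1]) (simp add: node_def)
  then have "M dvd x - y" by simp
  moreover have "\<bar>x - y\<bar> < \<bar>M\<bar>" using xy assms by auto
  ultimately show "x = y"
    using dvd_imp_le_int[of "x - y" M] by force
qed

text \<open>By injectivity the image has \<open>M\<close> elements, as many as the set that contains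
  it.\<close>

lemma node_image_full:
  assumes "1 \<le> M"
  shows "node M ` {j-M+1..j} = {1..M}"
proof (rule card_subset_eq)
  show "node M ` {j-M+1..j} \<subseteq> {1..M}" using node_mem[OF assms] by auto
  show "card (node M ` {j-M+1..j}) = card {1..M}"
    using inj_on_node[of j "j-M+1" M] by (simp add: card_image)
qed simp

lemma sum_cyc_full:
  assumes "1 \<le> M"
  shows "(\<Sum>i=j-M+1..j. cyc M a i) = (\<Sum>i=1..M. cyc M (a :: int \<Rightarrow> real) i)"
proof -
  have "(\<Sum>i=j-M+1..j. cyc M a i) = sum a (node M ` {j-M+1..j})"
    using inj_on_node[of j "j-M+1" M] by (simp add: sum.reindex cyc_eq)
  also have "\<dots> = sum a {1..M}"
    by (simp only: node_image_full[OF assms])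
  also have "\<dots> = (\<Sum>i=1..M. cyc M a i)"
    by (intro sum.cong) (simp_all add: cyc_eq node_id)
  finally show ?thesis .
qed

text \<open>The superdiagonal coefficient of the system. Its value 0 at \<open>k = M\<close> closes
  the system and merges the separate cases \<open>k < M\<close> and \<open>k = M\<close> of the
  explicit formulas.\<close>

definition coupling :: "int \<Rightarrow> (int \<Rightarrow> real) \<Rightarrow> int \<Rightarrow> int \<Rightarrow> real" where
  "coupling M q j k = (if k < M then cyc M q (j - k + 1) else 0)"

lemma lam_eq:
  assumes "1 \<le> M" "k \<le> M"
  shows "lam M p q j k = - (\<Sum>i=j-k+1..j. cyc M p i) - coupling M q j k"
  using assms sum_cyc_full[of M p j] by (cases "k = M") (auto simp: lam_def coupling_def)

text \<open>Component \<open>k\<close> of the eigenvector for \<open>lam M p q j l\<close>, scaled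
  to be 1 at \<open>k = l\<close>, where the product is empty. It covers all the products in
  \<open>v1\<close> and \<open>coef\<close>.\<close>

definition eigvec :: "int \<Rightarrow> (int \<Rightarrow> real) \<Rightarrow> (int \<Rightarrow> real) \<Rightarrow> int \<Rightarrow> int \<Rightarrow> int \<Rightarrow> real" where
  "eigvec M p q j l k = (\<Prod>m=j-l+2..j-k+1. - cyc M q m /
     ((\<Sum>i=j-l+1..m-1. cyc M p i) + coupling M q j l - cyc M q m))"

text \<open>Identifies the denominators in \<open>eigvec\<close> as eigenvalue gaps: the external
  rates from \<open>j - k + 1\<close> to \<open>j\<close> cancel.\<close>

lemma lam_diff:
  assumes "1 \<le> M" "1 \<le> k" "k < l" "l \<le> M"
  shows "(\<Sum>i=j-l+1..j-k. cyc M p i) + coupling M q j l - cyc M q (j-k+1)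
         = lam M p q j k - lam M p q j l"
proof -
  have "{j-l+1..j} = {j-l+1..j-k} \<union> {j-k+1..j}" using assms by auto
  then have "(\<Sum>i=j-l+1..j. cyc M p i) = (\<Sum>i=j-l+1..j-k. cyc M p i) + (\<Sum>i=j-k+1..j. cyc M p i)"
    by (simp add: sum.union_disjoint)
  then show ?thesis
    using assms by (simp add: lam_eq) (simp add: coupling_def)
qed

text \<open>Components \<open>k\<close> and \<open>k + 1\<close> differ by the single factor
  \<open>m = j - k + 1\<close>, whose denominator is an eigenvalue gap. Clearing it gives the
  eigenvector equation.\<close>

lemma eigvec_rec:
  assumes M: "1 \<le> M" and nz: "nonzero_denominators M p q j" and k: "1 \<le> k" "k < l" "l \<le> M"
  shows "(lam M p q j l - lam M p q j k) * eigvec M p q j l k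
         = coupling M q j k * eigvec M p q j l (k + 1)"
proof -
  let ?d = "(\<Sum>i=j-l+1..j-k. cyc M p i) + coupling M q j l - cyc M q (j-k+1)"
  have "{j-l+2..j-k+1} = insert (j-k+1) {j-l+2..j-k}" using k by auto
  then have "eigvec M p q j l k = - cyc M q (j-k+1) / ?d * eigvec M p q j l (k + 1)"
    by (simp add: eigvec_def)
  \<comment> \<open>The two clauses of \<open>nonzero_denominators\<close> cover
    \<open>l = M\<close> and \<open>l < M\<close>; \<open>k < l\<close> with
    \<open>1 \<le> k\<close> gives \<open>2 \<le> l\<close>.\<close>
  moreover have "?d \<noteq> 0"
  proof (cases "l = M")
    case True
    have "\<forall>m\<in>{j-M+2..j}. (\<Sum>i=j-M+1..m-1. cyc M p i) - cyc M q m \<noteq> 0"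
      using nz unfolding nonzero_denominators_def by blast
    moreover have "j-k+1 \<in> {j-M+2..j}" using k True by auto
    ultimately have "(\<Sum>i=j-M+1..j-k+1-1. cyc M p i) - cyc M q (j-k+1) \<noteq> 0" by blast
    then show ?thesis using True by (simp add: coupling_def)
  next
    case False
    have "\<forall>l\<in>{2..M-1}. \<forall>m\<in>{j-l+2..j}.
        (\<Sum>i=j-l+1..m-1. cyc M p i) + cyc M q (j-l+1) - cyc M q m \<noteq> 0"
      using nz unfolding nonzero_denominators_def by blast
    moreover have "l \<in> {2..M-1}" "j-k+1 \<in> {j-l+2..j}" using k False by auto
    ultimately have "(\<Sum>i=j-l+1..j-k+1-1. cyc M p i) + cyc M q (j-l+1) - cyc M q (j-k+1) \<noteq> 0"
      by blast
    then show ?thesis using False k by (simp add: coupling_def)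
  qed
  ultimately show ?thesis
    using k lam_diff[OF M k, where p = p and q = q and j = j] by (simp add: coupling_def divide_simps)
      (simp add: algebra_simps)
qed

lemma eigvec_self [simp]: "eigvec M p q j k k = 1"
  by (simp add: eigvec_def)

lemma v1_eq:
  assumes "1 \<le> k" "k \<le> M"
  shows "v1 M p q j k = eigvec M p q j k 1"
  using assms by (auto simp: v1_def eigvec_def coupling_def)

text \<open>Since the diagonal component is 1, the recursion for \<open>coef\<close> is this
  identity solved for its \<open>l = k\<close> term. It encodes the initial values 1.\<close>

lemma sum_coef_eigvec:
  assumes "1 \<le> k" "k \<le> M"
  shows "(\<Sum>l=k..M. coef M p q j l * eigvec M p q j l k) = 1"
proof (cases "k = M")
  case True
  then show ?thesis by (simp add: coef.simps)
next
  case False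
  then have km: "k < M" using assms by simp
  \<comment> \<open>Splits off \<open>l = k\<close>, which carries the coefficient solved for, and
    \<open>l = M\<close>, which the recursion lists separately.\<close>
  have "{k..M} = insert k (insert M {k+1..M-1})" using km by auto
  then have "(\<Sum>l=k..M. coef M p q j l * eigvec M p q j l k) = coef M p q j k
      + coef M p q j M * eigvec M p q j M k
      + (\<Sum>l=k+1..M-1. coef M p q j l * eigvec M p q j l k)"
    using km by simp
  moreover have "coef M p q j M = 1" by (simp add: coef.simps)
  moreover have "coef M p q j k = 1 - eigvec M p q j M k
      - (\<Sum>l=k+1..M-1. coef M p q j l * eigvec M p q j l k)"
    using km
    by (subst coef.simps) (simp add: eigvec_def coupling_def mult.commute algebra_simps)
  ultimately show ?thesis by simp
qed

subsection \<open>Runs of nonadopters\<close>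

text \<open>Real-valued, so that it can serve as the test function \<open>g\<close> in the forward
  equation.\<close>

definition all_zero :: "int set \<Rightarrow> (int \<Rightarrow> nat) \<Rightarrow> real" where
  "all_zero A y = of_bool (\<forall>i\<in>A. y i = 0)"

lemma finite_bass_states: "finite (bass_states M)"
  by (auto simp: bass_states_def intro: finite_PiE)

lemma bass_states_upd: "y \<in> bass_states M \<Longrightarrow> i \<in> {1..M} \<Longrightarrow> y(i := 1) \<in> bass_states M"
  by (auto simp: bass_states_def PiE_iff extensional_def)

text \<open>Each nonadopter \<open>i\<close> accounts for exactly one target state
  \<open>y(i := 1)\<close>, so the sum over states becomes a sum over nodes.\<close>

lemma bass_generator:
  assumes y: "y \<in> bass_states M"
  shows "(\<Sum>z\<in>bass_states M - {y}. bass_rate M p q y z * (g z - g y))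
         = (\<Sum>i | i \<in> {1..M} \<and> y i = 0.
              (p i + q i * real (cyc M y (i - 1))) * (g (y(i := 1)) - g y))"
proof -
  let ?S = "bass_states M - {y}" and ?J = "{i. i \<in> {1..M} \<and> y i = 0}"
  let ?w = "\<lambda>i. p i + q i * real (cyc M y (i - 1))"
  have fin: "finite ?S" "finite ?J"
    using finite_bass_states by (auto intro: finite_subset[of _ "{1..M}"])
  have "(\<Sum>z\<in>?S. bass_rate M p q y z * (g z - g y))
      = (\<Sum>z\<in>?S. \<Sum>i\<in>?J. if z = y(i := 1) then ?w i * (g (y(i := 1)) - g y) else 0)"
  proof (rule sum.cong)
    fix z
    \<comment> \<open>Turning the condition on the target into a conditional summand makes the index
      set independent of \<open>z\<close>, which permits the exchange of sums.\<close>
    have "bass_rate M p q y z = (\<Sum>i\<in>?J. if z = y(i := 1) then ?w i else 0)"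
      unfolding bass_rate_def
      by (rule sum.mono_neutral_cong_left) (use fin in auto)
    then show "bass_rate M p q y z * (g z - g y)
        = (\<Sum>i\<in>?J. if z = y(i := 1) then ?w i * (g (y(i := 1)) - g y) else 0)"
      by (auto simp: sum_distrib_right intro!: sum.cong)
  qed simp
  also have "\<dots> = (\<Sum>i\<in>?J. \<Sum>z\<in>?S. if z = y(i := 1) then ?w i * (g (y(i := 1)) - g y) else 0)"
    by (rule sum.swap)
  also have "\<dots> = (\<Sum>i\<in>?J. ?w i * (g (y(i := 1)) - g y))"
  proof (rule sum.cong)
    fix i assume i: "i \<in> ?J"
    then have "y(i := 1) \<in> ?S" using bass_states_upd[OF y] by (auto simp: fun_eq_iff)
    then show "(\<Sum>z\<in>?S. if z = y(i := 1) then ?w i * (g (y(i := 1)) - g y) else 0)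
        = ?w i * (g (y(i := 1)) - g y)"
      using fin by simp
  qed simp
  finally show ?thesis .
qed

text \<open>An adoption inside \<open>A\<close> destroys the event, one outside leaves it unchanged,
  and none can restore it. The event is thus lost at the total adoption rate of
  \<open>A\<close>.\<close>

lemma bass_generator_all_zero:
  assumes y: "y \<in> bass_states M" and A: "A \<subseteq> {1..M}"
  shows "(\<Sum>z\<in>bass_states M - {y}. bass_rate M p q y z * (all_zero A z - all_zero A y))
         = - all_zero A y * (\<Sum>i\<in>A. p i + q i * real (cyc M y (i - 1)))"
proof (cases "\<forall>i\<in>A. y i = 0")
  case False
  then have "all_zero A y = 0" "all_zero A (y(i := 1)) = 0" for i
    by (auto simp: all_zero_def)
  then show ?thesis unfolding bass_generator[OF y] by simp
next
  case True
  then have "all_zero A y = 1" "all_zero A (y(i := 1)) = of_bool (i \<notin> A)" for i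
    by (auto simp: all_zero_def)
  moreover have "(\<Sum>i | i \<in> {1..M} \<and> y i = 0.
        (p i + q i * real (cyc M y (i - 1))) * (of_bool (i \<notin> A) - 1))
      = (\<Sum>i\<in>A. - (p i + q i * real (cyc M y (i - 1))))"
    using A True by (intro sum.mono_neutral_cong_right) (auto intro: finite_subset[of _ "{1..M}"])
  ultimately show ?thesis unfolding bass_generator[OF y] by (simp add: sum_negf[symmetric])
qed

definition run :: "int \<Rightarrow> int \<Rightarrow> int \<Rightarrow> int set" where
  "run M j k = node M ` {j-k+1..j}"

text \<open>Within a run of nonadopters only the leftmost node can have an adopting left neighbor.
  That neighbor adopts exactly when the run of length \<open>k\<close> does not extend to length
  \<open>k + 1\<close>, so the equations involve runs only.\<close>

lemma bass_generator_run:
  assumes M: "1 \<le> M" and y: "y \<in> bass_states M" and k: "k \<in> {1..M}"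
  shows "(\<Sum>z\<in>bass_states M - {y}. bass_rate M p q y z * (all_zero (run M j k) z - all_zero (run M j k) y))
         = lam M p q j k * all_zero (run M j k) y + coupling M q j k * all_zero (run M j (k + 1)) y"
proof (cases "\<forall>i\<in>run M j k. y i = 0")
  case False
  moreover have "run M j k \<subseteq> run M j (k + 1)" by (auto simp: run_def)
  ultimately have "all_zero (run M j k) y = 0" "all_zero (run M j (k + 1)) y = 0"
    by (auto simp: all_zero_def)
  moreover have "run M j k \<subseteq> {1..M}" using node_mem[OF M] by (auto simp: run_def)
  ultimately show ?thesis by (subst bass_generator_all_zero[OF y]) simp_all
next
  case True
  then have one: "all_zero (run M j k) y = 1" by (simp add: all_zero_def)
  have sub: "run M j k \<subseteq> {1..M}" using node_mem[OF M] by (auto simp: run_def)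
  have zero: "y (node M i) = 0" if "i \<in> {j-k+1..j}" for i
    using True that by (auto simp: run_def)
  define s where "s = real (y (node M (j - k)))"
  have "(\<Sum>i\<in>run M j k. p i + q i * real (cyc M y (i - 1)))
      = (\<Sum>i=j-k+1..j. cyc M p i + cyc M q i * real (y (node M (i - 1))))"
    using inj_on_node[of j "j-k+1" M] k
    by (simp add: run_def sum.reindex cyc_eq node_node_diff_1)
  also have "\<dots> = (\<Sum>i=j-k+1..j. cyc M p i) + (\<Sum>i=j-k+1..j. cyc M q i * real (y (node M (i - 1))))"
    by (rule sum.distrib)
  \<comment> \<open>For every other \<open>i\<close> the left neighbor \<open>i - 1\<close> belongs
    to the run.\<close>
  also have "(\<Sum>i=j-k+1..j. cyc M q i * real (y (node M (i - 1))))
      = (\<Sum>i\<in>{j-k+1}. cyc M q i * real (y (node M (i - 1))))"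
    using k zero by (intro sum.mono_neutral_right) auto
  also have "\<dots> = cyc M q (j-k+1) * s" by (simp add: s_def)
  also have "\<dots> = coupling M q j k * (1 - all_zero (run M j (k + 1)) y)"
  proof (cases "k = M")
    \<comment> \<open>The run is the whole circle, and the left neighbor of its first node is
      \<open>j\<close> itself.\<close>
    case True
    then have "s = 0" using zero[of j] k by (simp add: s_def node_diff_self)
    then show ?thesis using True by (simp add: coupling_def)
  next
    case False
    have "{j-(k+1)+1..j} = insert (j-k) {j-k+1..j}" using k by auto
    then have "run M j (k + 1) = insert (node M (j - k)) (run M j k)" by (simp add: run_def)
    then have "all_zero (run M j (k + 1)) y = of_bool (y (node M (j - k)) = 0)"
      using True by (simp add: all_zero_def)
    moreover have "y (node M (j - k)) \<in> {0, 1}"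
      using y node_mem[OF M] by (auto simp: bass_states_def PiE_iff)
    ultimately have "s = 1 - all_zero (run M j (k + 1)) y" by (auto simp: s_def)
    then show ?thesis using False k by (simp add: coupling_def)
  qed
  finally show ?thesis
    using k M unfolding bass_generator_all_zero[OF y sub] unfolding one
    by (simp add: lam_eq algebra_simps)
qed

subsection \<open>The law of the process\<close>

lemma bass_circle_prob_space: "bass_circle \<Omega> M p q X \<Longrightarrow> prob_space \<Omega>"
  unfolding bass_circle_def ctmc_def by (elim conjE)

lemma bass_circle_state:
  assumes "bass_circle \<Omega> M p q X" "0 \<le> t"
  shows "(\<lambda>\<omega>. \<lambda>j\<in>{1..M}. X j t \<omega>) \<in> measurable \<Omega> (count_space (bass_states M))"
  using assms(1)[unfolded bass_circle_def ctmc_def, THEN conjunct1, THEN conjunct2,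
      THEN conjunct2, THEN conjunct1, rule_format, OF assms(2)] .

lemma bass_circle_values:
  assumes "bass_circle \<Omega> M p q X" "0 \<le> t" "\<omega> \<in> space \<Omega>" "j \<in> {1..M}"
  shows "X j t \<omega> \<in> {0, 1}"
  using measurable_space[OF bass_circle_state[OF assms(1,2)] assms(3)] assms(4)
  by (auto simp: bass_states_def PiE_iff)

lemma bass_circle_component_measurable:
  assumes "bass_circle \<Omega> M p q X" "0 \<le> t" "j \<in> {1..M}"
  shows "X j t \<in> measurable \<Omega> (count_space UNIV)"
proof -
  have "(\<lambda>\<omega>. (\<lambda>y. y j) (\<lambda>j\<in>{1..M}. X j t \<omega>)) \<in> measurable \<Omega> (count_space UNIV)"
    by (rule measurable_compose[OF bass_circle_state[OF assms(1,2)]]) simp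
  then show ?thesis using assms by simp
qed

text \<open>The initial state is almost surely zero, so the Markov property from time 0 identifies
  the law at time \<open>t\<close> with a row of \<open>P t\<close>.\<close>

lemma bass_circle_law:
  assumes "bass_circle \<Omega> M p q X" "1 \<le> M"
  obtains P where "transition_function (bass_states M) (bass_rate M p q) P"
    "\<And>t y. 0 \<le> t \<Longrightarrow> y \<in> bass_states M \<Longrightarrow>
       measure \<Omega> {\<omega> \<in> space \<Omega>. (\<lambda>j\<in>{1..M}. X j t \<omega>) = y} = P t (\<lambda>j\<in>{1..M}. 0) y"
proof -
  let ?x = "\<lambda>j\<in>{1..M}. 0 :: nat"
  interpret prob_space \<Omega> using assms(1) by (rule bass_circle_prob_space)
  have "\<exists>P. transition_function (bass_states M) (bass_rate M p q) P \<and>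
      (\<forall>T t h \<xi>. \<forall>x\<in>bass_states M. \<forall>y\<in>bass_states M.
         finite T \<and> T \<subseteq> {0..t} \<and> 0 \<le> t \<and> 0 \<le> h \<longrightarrow>
         measure \<Omega> {\<omega> \<in> space \<Omega>. (\<forall>s\<in>T. (\<lambda>j\<in>{1..M}. X j s \<omega>) = \<xi> s)
             \<and> (\<lambda>j\<in>{1..M}. X j t \<omega>) = x \<and> (\<lambda>j\<in>{1..M}. X j (t + h) \<omega>) = y}
         = measure \<Omega> {\<omega> \<in> space \<Omega>. (\<forall>s\<in>T. (\<lambda>j\<in>{1..M}. X j s \<omega>) = \<xi> s)
             \<and> (\<lambda>j\<in>{1..M}. X j t \<omega>) = x} * P h x y)"
    using assms(1) unfolding bass_circle_def ctmc_def by (elim conjE)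
  then obtain P where tf: "transition_function (bass_states M) (bass_rate M p q) P"
    and markov: "\<forall>T t h \<xi>. \<forall>x\<in>bass_states M. \<forall>y\<in>bass_states M.
         finite T \<and> T \<subseteq> {0..t} \<and> 0 \<le> t \<and> 0 \<le> h \<longrightarrow>
         measure \<Omega> {\<omega> \<in> space \<Omega>. (\<forall>s\<in>T. (\<lambda>j\<in>{1..M}. X j s \<omega>) = \<xi> s)
             \<and> (\<lambda>j\<in>{1..M}. X j t \<omega>) = x \<and> (\<lambda>j\<in>{1..M}. X j (t + h) \<omega>) = y}
         = measure \<Omega> {\<omega> \<in> space \<Omega>. (\<forall>s\<in>T. (\<lambda>j\<in>{1..M}. X j s \<omega>) = \<xi> s)
             \<and> (\<lambda>j\<in>{1..M}. X j t \<omega>) = x} * P h x y"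
    by (elim exE conjE) (rule that)
  have start: "AE \<omega> in \<Omega>. (\<lambda>j\<in>{1..M}. X j 0 \<omega>) = ?x"
    using assms(1) unfolding bass_circle_def by (auto elim!: eventually_mono)
  have sets: "{\<omega> \<in> space \<Omega>. (\<lambda>j\<in>{1..M}. X j t \<omega>) = y} \<in> sets \<Omega>"
    if "0 \<le> t" "y \<in> bass_states M" for t y
    using measurable_sets[OF bass_circle_state[OF assms(1) that(1)], of "{y}"] that
    by (simp add: vimage_def Int_def conj_commute)
  have x: "?x \<in> bass_states M" by (auto simp: bass_states_def)
  have "measure \<Omega> {\<omega> \<in> space \<Omega>. (\<lambda>j\<in>{1..M}. X j t \<omega>) = y} = P t ?x y"
    if t: "0 \<le> t" and y: "y \<in> bass_states M" for t y
  proof -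
    have 1: "measure \<Omega> {\<omega> \<in> space \<Omega>. (\<lambda>j\<in>{1..M}. X j 0 \<omega>) = ?x} = 1"
      using start sets[OF _ x, of 0] by (subst prob_Collect_eq_1) auto
    have "{\<omega> \<in> space \<Omega>. (\<lambda>j\<in>{1..M}. X j 0 \<omega>) = ?x \<and> (\<lambda>j\<in>{1..M}. X j t \<omega>) = y}
        = {\<omega> \<in> space \<Omega>. (\<lambda>j\<in>{1..M}. X j 0 \<omega>) = ?x}
          \<inter> {\<omega> \<in> space \<Omega>. (\<lambda>j\<in>{1..M}. X j t \<omega>) = y}"
      by auto
    then have "{\<omega> \<in> space \<Omega>. (\<lambda>j\<in>{1..M}. X j 0 \<omega>) = ?x \<and> (\<lambda>j\<in>{1..M}. X j t \<omega>) = y} \<in> sets \<Omega>"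
      using sets[OF _ x, of 0] sets[OF t y] by simp
    \<comment> \<open>Intersecting with the almost sure initial event preserves the
      probability.\<close>
    then have "measure \<Omega> {\<omega> \<in> space \<Omega>. (\<lambda>j\<in>{1..M}. X j t \<omega>) = y}
        = measure \<Omega> {\<omega> \<in> space \<Omega>. (\<lambda>j\<in>{1..M}. X j 0 \<omega>) = ?x \<and> (\<lambda>j\<in>{1..M}. X j t \<omega>) = y}"
      using start sets[OF t y] by (intro finite_measure_eq_AE) auto
    also have "\<dots> = P t ?x y"
      using markov[rule_format, where T = "{}" and t = 0 and h = t, OF x y] t 1 by simp
    finally show ?thesis .
  qed
  then show ?thesis by (rule that[OF tf])
qed

text \<open>The event is partitioned according to the finitely many states of the whole
  circle.\<close>

lemma nonadopter_prob_eq: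
  assumes bc: "bass_circle \<Omega> M p q X" and t: "0 \<le> t" and j: "j \<in> {1..M}"
    and law: "\<And>y. y \<in> bass_states M \<Longrightarrow>
       measure \<Omega> {\<omega> \<in> space \<Omega>. (\<lambda>j\<in>{1..M}. X j t \<omega>) = y} = L y"
  shows "nonadopter_prob \<Omega> X j t = (\<Sum>y\<in>bass_states M. L y * all_zero {j} y)"
proof -
  interpret prob_space \<Omega> using bc by (rule bass_circle_prob_space)
  let ?E = "\<lambda>y. {\<omega> \<in> space \<Omega>. (\<lambda>j\<in>{1..M}. X j t \<omega>) = y}"
  let ?S = "{y \<in> bass_states M. y j = 0}"
  have "{\<omega> \<in> space \<Omega>. X j t \<omega> = 0} = (\<Union>y\<in>?S. ?E y)"
    using measurable_space[OF bass_circle_state[OF bc t]] j by auto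
  moreover have "?E ` ?S \<subseteq> sets \<Omega>"
  proof clarify
    fix y assume "y \<in> bass_states M"
    then show "?E y \<in> sets \<Omega>"
      using measurable_sets[OF bass_circle_state[OF bc t], of "{y}"]
      by (simp add: vimage_def Int_def conj_commute)
  qed
  ultimately have "nonadopter_prob \<Omega> X j t = (\<Sum>y\<in>?S. measure \<Omega> (?E y))"
    unfolding nonadopter_prob_def
    by (simp only:) (rule finite_measure_finite_Union,
      auto simp: finite_bass_states disjoint_family_on_def)
  also have "\<dots> = (\<Sum>y\<in>bass_states M. L y * all_zero {j} y)"
    using finite_bass_states law
    by (intro sum.mono_neutral_cong_left) (auto simp: all_zero_def)
  finally show ?thesis .
qed

text \<open>Each \<open>X j t\<close> takes only the values 0 and 1, hence equals 1 minus the
  indicator of nonadoption; linearity of the integral does the rest.\<close>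

lemma adopter_fraction_eq:
  assumes M: "1 \<le> M" and bc: "bass_circle \<Omega> M p q X" and t: "0 \<le> t"
  shows "adopter_fraction \<Omega> M X t
         = 1 - 1 / real_of_int M * (\<Sum>j=1..M. nonadopter_prob \<Omega> X j t)"
proof -
  interpret prob_space \<Omega> using bc by (rule bass_circle_prob_space)
  have sets: "{\<omega> \<in> space \<Omega>. X j t \<omega> = 0} \<in> sets \<Omega>" if "j \<in> {1..M}" for j
    using measurable_sets[OF bass_circle_component_measurable[OF bc t that], of "{0}"]
    by (simp add: vimage_def Int_def conj_commute)
  have "integral\<^sup>L \<Omega> (\<lambda>\<omega>. \<Sum>j=1..M. real (X j t \<omega>))
      = integral\<^sup>L \<Omega> (\<lambda>\<omega>. \<Sum>j=1..M. 1 - indicator {\<omega> \<in> space \<Omega>. X j t \<omega> = 0} \<omega>)"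
  proof (intro Bochner_Integration.integral_cong sum.cong refl)
    fix \<omega> j assume "\<omega> \<in> space \<Omega>" "j \<in> {1..M}"
    then show "real (X j t \<omega>) = 1 - indicator {\<omega> \<in> space \<Omega>. X j t \<omega> = 0} \<omega>"
      using bass_circle_values[OF bc t] by (fastforce simp: indicator_def)
  qed
  also have "\<dots> = (\<Sum>j=1..M. 1 - nonadopter_prob \<Omega> X j t)"
    using sets by (simp add: nonadopter_prob_def prob_space emeasure_eq_measure)
  finally show ?thesis
    using M by (simp add: adopter_fraction_def sum_subtractf right_diff_distrib)
qed

lemma nonadopter_prob_formula:
  assumes M: "1 \<le> M" and bc: "bass_circle \<Omega> M p q X" and t: "0 \<le> t" and j: "j \<in> {1..M}"
    and nz: "nonzero_denominators M p q j"
  shows "nonadopter_prob \<Omega> X j t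
         = (\<Sum>k=1..M. coef M p q j k * v1 M p q j k * exp (lam M p q j k * t))"
proof -
  obtain P where tf: "transition_function (bass_states M) (bass_rate M p q) P"
    and law: "\<And>t y. 0 \<le> t \<Longrightarrow> y \<in> bass_states M \<Longrightarrow>
       measure \<Omega> {\<omega> \<in> space \<Omega>. (\<lambda>j\<in>{1..M}. X j t \<omega>) = y} = P t (\<lambda>j\<in>{1..M}. 0) y"
    by (rule bass_circle_law[OF bc M]) (rule that, assumption, simp)
  let ?x = "\<lambda>j\<in>{1..M}. 0 :: nat"
  have x: "?x \<in> bass_states M" by (auto simp: bass_states_def)
  \<comment> \<open>\<open>F\<close> is the eigenvector expansion, with the claimed formula as
    \<open>F 1\<close>; \<open>G k\<close> is the probability that the run of length
    \<open>k\<close> has no adopter.\<close>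
  define F where
    "F k t = (\<Sum>l=k..M. coef M p q j l * eigvec M p q j l k * exp (lam M p q j l * t))" for k t
  text \<open>Cut off to agree with the empty sum \<open>F (M + 1) t\<close>.\<close>
  define G where
    "G k t = (if k \<le> M then \<Sum>y\<in>bass_states M. P t ?x y * all_zero (run M j k) y else 0)" for k t
  have "F 1 t = G 1 t"
  proof (rule triangular_system_unique
      [where F = F and G = G and M = M and \<mu> = "lam M p q j" and a = "coupling M q j"])
    fix k t assume k: "k \<in> {1..M}" and t: "0 \<le> (t::real)"
    show "(F k has_real_derivative lam M p q j k * F k t + coupling M q j k * F (k + 1) t)
        (at t within {0..})"
      by (rule triangular_system_solution[OF eigvec_rec[OF M nz] F_def k])
    have "((\<lambda>s. \<Sum>y\<in>bass_states M. P s ?x y * all_zero (run M j k) y) has_real_derivative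
        (\<Sum>y\<in>bass_states M. P t ?x y * (lam M p q j k * all_zero (run M j k) y
           + coupling M q j k * all_zero (run M j (k + 1)) y))) (at t within {0..})"
      using transition_function_forward_equation[OF tf finite_bass_states x t,
          of "all_zero (run M j k)"]
      by (simp add: bass_generator_run[OF M _ k] cong: sum.cong)
    \<comment> \<open>For \<open>k = M\<close> the cut-off makes \<open>G (k + 1)\<close> zero,
      while the run of length \<open>M + 1\<close> wraps around; both are multiplied by
      \<open>coupling M q j M = 0\<close>.\<close>
    moreover have "(\<Sum>y\<in>bass_states M. P t ?x y * (lam M p q j k * all_zero (run M j k) y
           + coupling M q j k * all_zero (run M j (k + 1)) y))
        = lam M p q j k * G k t + coupling M q j k * G (k + 1) t"
      using k by (auto simp: G_def coupling_def sum_distrib_left distrib_left sum.distrib mult_ac)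
    moreover have "G k = (\<lambda>s. \<Sum>y\<in>bass_states M. P s ?x y * all_zero (run M j k) y)"
      using k by (auto simp: G_def)
    ultimately show "(G k has_real_derivative
        lam M p q j k * G k t + coupling M q j k * G (k + 1) t) (at t within {0..})"
      by (simp only:)
  next
    fix k assume k: "k \<in> {1..M}"
    have "all_zero (run M j k) ?x = 1"
      using node_mem[OF M] by (auto simp: all_zero_def run_def)
    moreover have "P 0 ?x y = of_bool (?x = y)" if "y \<in> bass_states M" for y
      by (rule transition_function_start[OF tf x that])
    ultimately have "G k 0 = 1"
      using k x finite_bass_states by (simp add: G_def cong: sum.cong)
    \<comment> \<open>At time 0 the exponentials are 1, and the choice of \<open>coef\<close> makes
      the expansion equal to 1.\<close>
    then show "F k 0 = G k 0"
      using k sum_coef_eigvec by (simp add: F_def)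
  qed (use M t in \<open>auto simp: F_def G_def\<close>)
  moreover have "run M j 1 = {j}"
    using j by (simp add: run_def node_id)
  then have "nonadopter_prob \<Omega> X j t = G 1 t"
    using nonadopter_prob_eq[OF bc t j law[OF t]] M by (simp add: G_def)
  ultimately show ?thesis
    by (simp add: F_def v1_eq)
qed

theorem theorem6:
  fixes \<Omega> :: "'w measure" and M :: int and p q :: "int \<Rightarrow> real"
    and X :: "int \<Rightarrow> real \<Rightarrow> 'w \<Rightarrow> nat" and t :: real
  assumes "1 \<le> M"
    and "\<And>j. j \<in> {1..M} \<Longrightarrow> 0 \<le> p j"
    and "\<And>j. j \<in> {1..M} \<Longrightarrow> 0 < q j"
    and "bass_circle \<Omega> M p q X"
    and "0 \<le> t"
  shows "adopter_fraction \<Omega> M X t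
           = 1 - 1 / real_of_int M * (\<Sum>j=1..M. nonadopter_prob \<Omega> X j t)
         \<and> (\<forall>j\<in>{1..M}. nonzero_denominators M p q j \<longrightarrow>
              nonadopter_prob \<Omega> X j t
                = (\<Sum>k=1..M. coef M p q j k * v1 M p q j k * exp (lam M p q j k * t)))"
  using adopter_fraction_eq[OF assms(1,4,5)] nonadopter_prob_formula[OF assms(1,4,5)] by blast

end
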